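(* Let $\varepsilon>0$. There exist a probability space $(\Omega,\mathbb P)$ and a uniformly bounded, real valued orthonormal system $(\varphi_n)_{n\ge1}$ in $L_2(\Omega,\mathbb P)$ with $\|\varphi_n\|_\infty\le 1+\varepsilon$ for all $n$, which is a martingale difference sequence, which is subgaussian and actually satisfies $$\mathbb E\, e^{\sum x_n\varphi_n}\le e^{(1+\varepsilon)^2\sum x_n^2/2}$$ for every finite sequence of real numbers $(x_n)$, but which is not a Sidon system. More precisely, for each $n\ge1$ let $C_n$ be the smallest constant such that for all scalar coefficients $(x_k)$ $$\sum_{k=1}^n|x_k|\le C_n\Big\|\sum_{k=1}^n x_k\varphi_k\Big\|_\infty .$$ Then $$\forall n\ge1\qquad C_n\ge\delta_\varepsilon\sqrt n,$$ where $\delta_\varepsilon>0$ depends only on $\varepsilon$.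
   Context: Scalars are complex. A system $(\varphi_n)$ of bounded functions on a probability space is called Sidon if there is a constant $C$ such that $\sum|x_n|\le C\|\sum x_n\varphi_n\|_\infty$ for every finitely supported scalar sequence $(x_n)$; the smallest such $C$ is its Sidon constant. The system $(\varphi_n)$ on a probability space $(T,m)$ is subgaussian if there is a constant $\beta$ such that $\int e^{|\sum x_n\varphi_n|^2/\beta^2}\,dm\le e$ for every finite scalar sequence $(x_n)$ with $\sum|x_n|^2\le1$. A sequence $(\varphi_n)_{n\ge1}$ is a martingale difference sequence if there is an increasing sequence of $\sigma$-algebras $(\mathcal A_n)_{n\ge0}$ such that $\varphi_n$ is integrable and $\mathcal A_n$-measurable and $\mathbb E^{\mathcal A_{n-1}}\varphi_n=0$ for all $n\ge1$. *)

theory Defs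
  imports "HOL-Probability.Probability"
begin

text \<open>
  A system is a family of functions on a measure space, indexed by a set \<open>I\<close> of natural numbers;
  values outside \<open>I\<close> are irrelevant. Finite sequences of coefficients are given by a finite
  \<open>F \<subseteq> I\<close> together with the values of \<open>x\<close> on \<open>F\<close>.
\<close>

definition Linf_norm :: "'a measure \<Rightarrow> ('a \<Rightarrow> complex) \<Rightarrow> ereal" where
  "Linf_norm M f = esssup M (\<lambda>\<omega>. ereal (cmod (f \<omega>)))"

definition sidon_bound :: "'a measure \<Rightarrow> (nat \<Rightarrow> 'a \<Rightarrow> complex) \<Rightarrow> nat set \<Rightarrow> real \<Rightarrow> bool" where
  "sidon_bound M \<phi> F C \<longleftrightarrow>
     (\<forall>x :: nat \<Rightarrow> complex.
        ereal (\<Sum>k\<in>F. cmod (x k)) \<le> ereal C * Linf_norm M (\<lambda>\<omega>. \<Sum>k\<in>F. x k * \<phi> k \<omega>))"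

definition sidon :: "'a measure \<Rightarrow> (nat \<Rightarrow> 'a \<Rightarrow> complex) \<Rightarrow> nat set \<Rightarrow> bool" where
  "sidon M \<phi> I \<longleftrightarrow> (\<exists>C. \<forall>F. finite F \<and> F \<subseteq> I \<longrightarrow> sidon_bound M \<phi> F C)"

definition is_smallest :: "'a::order set \<Rightarrow> 'a \<Rightarrow> bool" where
  "is_smallest S c \<longleftrightarrow> c \<in> S \<and> (\<forall>d\<in>S. c \<le> d)"

text \<open>
  The integrands below are nonnegative; the nonnegative integral is used so that the bounds
  include finiteness (the Bochner integral of a non-integrable function is 0). The condition
  \<open>\<beta> > 0\<close> rules out the degenerate reading of division by 0.
\<close>

definition subgaussian :: "'a measure \<Rightarrow> (nat \<Rightarrow> 'a \<Rightarrow> complex) \<Rightarrow> nat set \<Rightarrow> bool" where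
  "subgaussian M \<phi> I \<longleftrightarrow>
     (\<exists>\<beta> > 0. \<forall>F (x :: nat \<Rightarrow> complex).
        finite F \<and> F \<subseteq> I \<and> (\<Sum>k\<in>F. (cmod (x k))\<^sup>2) \<le> 1 \<longrightarrow>
        (\<integral>\<^sup>+\<omega>. ennreal (exp ((cmod (\<Sum>k\<in>F. x k * \<phi> k \<omega>))\<^sup>2 / \<beta>\<^sup>2)) \<partial>M) \<le> ennreal (exp 1))"

definition orthonormal_system :: "'a measure \<Rightarrow> (nat \<Rightarrow> 'a \<Rightarrow> real) \<Rightarrow> nat set \<Rightarrow> bool" where
  "orthonormal_system M \<phi> I \<longleftrightarrow>
     (\<forall>n\<in>I. \<phi> n \<in> borel_measurable M \<and> integrable M (\<lambda>\<omega>. (\<phi> n \<omega>)\<^sup>2)) \<and>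
     (\<forall>m\<in>I. \<forall>n\<in>I. (\<integral>\<omega>. \<phi> m \<omega> * \<phi> n \<omega> \<partial>M) = (if m = n then 1 else 0))"

text \<open>Martingale differences are indexed from 1, the filtration from 0.\<close>

definition martingale_difference :: "'a measure \<Rightarrow> (nat \<Rightarrow> 'a \<Rightarrow> real) \<Rightarrow> bool" where
  "martingale_difference M \<phi> \<longleftrightarrow>
     (\<exists>A :: nat \<Rightarrow> 'a measure.
        filtration (space M) A \<and> (\<forall>n. subalgebra M (A n)) \<and>
        (\<forall>n\<ge>1. integrable M (\<phi> n) \<and> \<phi> n \<in> borel_measurable (A n) \<and>
          (AE \<omega> in M. real_cond_exp M (A (n - 1)) (\<phi> n) \<omega> = 0)))"

end

theory Submission
  imports Defs
begin

text \<open>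
  The Sidon property fails as soon as the partial sums of the system are uniformly of order
  \<open>sqrt n\<close>: with \<open>n\<close> coefficients equal to 1, a bound
  \<open>\<bar>\<phi> 1 + \<dots> + \<phi> n\<bar> \<le> B * sqrt n\<close> forces \<open>C n \<ge> sqrt n / B\<close>. The sums of independent signs have
  typical size \<open>sqrt n\<close> but maximum \<open>n\<close>. The idea is to suppress the rare large
  values without losing the martingale structure: a random walk with fair signs skips its \<open>n\<close>-th
  step whenever its position exceeds \<open>K * sqrt n\<close>. Such a walk never goes beyond
  \<open>K * sqrt n\<close> by more than one step (\<open>walk\<close>).

  A step that is sometimes skipped has variance less than 1, so it is multiplied by
  \<open>1 / sqrt p\<close>, where \<open>p\<close> is the probability that it is made. The second moment of the
  walk after \<open>n\<close> steps is then at most \<open>n\<close> by orthogonality of the increments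
  (\<open>second_moment_walk_le\<close>), and Chebyshev's inequality gives \<open>p \<ge> 1 - 1 / K\<^sup>2\<close> for every step
  (\<open>prob_walk_confined\<close>). If \<open>K\<close> is large enough, depending on \<open>\<epsilon>\<close>, then
  \<open>1 / sqrt p \<le> 1 + \<epsilon>\<close>. The functions \<open>\<phi> n\<close> are the increments of this walk.

  Orthogonality, the martingale property and the subgaussian estimates hold for any system of the form \<open>\<phi> n \<omega> = \<omega> n * h n \<omega>\<close> with a gate
  \<open>h n\<close> that is bounded by \<open>b\<close> and depends on the coins before the \<open>n\<close>-th one only
  (\<open>gated_signs\<close>). Reversing the \<open>n\<close>-th coin preserves the measure, fixes the past and changes the
  sign of \<open>\<phi> n\<close>. This gives the martingale property, hence orthogonality, and it reduces each factor of
  an exponential moment to \<open>cosh (x * \<phi> n) \<le> exp (b\<^sup>2 * x\<^sup>2 / 2)\<close> (\<open>exp_moment\<close>). The square-exponential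
  form of the subgaussian property follows by integrating exponential moments against a Gaussian
  weight (\<open>square_exp_moment_le\<close>).
\<close>

section \<open>Independent fair signs\<close>

text \<open>
  The factors are the two-point spaces \<open>{-1, 1}\<close> and not the real line with a two-point
  distribution: every point of the product is then a sequence of signs, and identities such as
  \<open>(\<omega> n)\<^sup>2 = 1\<close> hold everywhere and not just almost everywhere.
\<close>

definition coin_space :: "(nat \<Rightarrow> real) measure" where
  "coin_space = Pi\<^sub>M UNIV (\<lambda>_. uniform_count_measure {-1, 1})"

lemma prob_space_fair_sign: "prob_space (uniform_count_measure {-1, 1 :: real})"
  by (rule prob_space_uniform_count_measure) auto

interpretation coin: product_prob_space "\<lambda>_::nat. uniform_count_measure {-1, 1 :: real}" UNIV
  by (simp add: product_prob_spaceI prob_space_fair_sign)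

lemma prob_space_coin_space: "prob_space coin_space"
  unfolding coin_space_def by (rule coin.P.prob_space_axioms)

interpretation coin_space: prob_space coin_space
  by (rule prob_space_coin_space)

lemma space_coin_space: "space coin_space = (UNIV \<rightarrow> {-1, 1})"
  by (auto simp: coin_space_def space_PiM space_uniform_count_measure PiE_def)

lemma sign_cases: "\<omega> \<in> space coin_space \<Longrightarrow> \<omega> n = 1 \<or> \<omega> n = -1"
  by (auto simp: space_coin_space Pi_iff)

lemma abs_sign [simp]: "\<omega> \<in> space coin_space \<Longrightarrow> \<bar>\<omega> n\<bar> = 1"
  using sign_cases[of \<omega> n] by auto

lemma sign_squared [simp]: "\<omega> \<in> space coin_space \<Longrightarrow> (\<omega> n)\<^sup>2 = 1"
  using sign_cases[of \<omega> n] by auto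

lemma measurable_sign [measurable]: "(\<lambda>\<omega>. \<omega> n) \<in> borel_measurable coin_space"
proof -
  have "(\<lambda>\<omega>. \<omega> n) \<in> measurable coin_space (uniform_count_measure {-1, 1})"
    unfolding coin_space_def by measurable
  moreover have "(\<lambda>x. x) \<in> borel_measurable (uniform_count_measure {-1, 1 :: real})"
    by (simp add: uniform_count_measure_def)
  ultimately show ?thesis
    by (rule measurable_compose)
qed

definition flip :: "nat \<Rightarrow> (nat \<Rightarrow> real) \<Rightarrow> nat \<Rightarrow> real" where
  "flip n \<omega> = fun_upd \<omega> n (- \<omega> n)"

lemma flip_in_space: "\<omega> \<in> space coin_space \<Longrightarrow> flip n \<omega> \<in> space coin_space"
  by (auto simp: flip_def space_coin_space Pi_iff)

lemma measurable_flip [measurable]: "flip n \<in> measurable coin_space coin_space"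
proof -
  have neg: "uminus \<in> measurable (uniform_count_measure {-1, 1 :: real}) (uniform_count_measure {-1, 1})"
    by (auto simp: measurable_def space_uniform_count_measure sets_uniform_count_measure)
  have "(\<lambda>\<omega>. flip n \<omega> i) \<in> measurable coin_space (uniform_count_measure {-1, 1})" for i
    using neg unfolding coin_space_def flip_def by (cases "i = n") (auto intro: measurable_compose)
  moreover have "flip n \<in> space coin_space \<rightarrow> (UNIV \<rightarrow>\<^sub>E space (uniform_count_measure {-1, 1}))"
    using flip_in_space by (simp add: Pi_iff coin_space_def space_PiM PiE_def)
  ultimately show ?thesis
    unfolding coin_space_def by (intro measurable_PiM_single') auto
qed

text \<open>
  A product measure is determined by its values on boxes over finitely many coordinates. The
  preimage of a box under \<open>flip n\<close> is the box whose \<open>n\<close>-th side is reflected, and a reflected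
  side has the same cardinality, hence the same probability.
\<close>

lemma distr_flip: "distr coin_space coin_space (flip n) = coin_space"
proof -
  have "distr coin_space coin_space (flip n) = Pi\<^sub>M UNIV (\<lambda>_. uniform_count_measure {-1, 1})"
  proof (rule coin.PiM_eq)
    show "sets (distr coin_space coin_space (flip n)) = sets (Pi\<^sub>M UNIV (\<lambda>_. uniform_count_measure {-1, 1}))"
      by (simp add: coin_space_def)
    fix J :: "nat set" and F :: "nat \<Rightarrow> real set"
    assume J: "finite J" "J \<subseteq> UNIV"
      and F: "\<And>j. j \<in> J \<Longrightarrow> F j \<in> sets (uniform_count_measure {-1, 1})"
    define G where "G j = (if j = n then uminus ` F j else F j)" for j
    let ?emb = "prod_emb UNIV (\<lambda>_::nat. uniform_count_measure {-1, 1 :: real}) J"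
    have G: "G j \<in> sets (uniform_count_measure {-1, 1})" if "j \<in> J" for j
      using F[OF that] by (auto simp: G_def sets_uniform_count_measure)
    have mem: "x \<in> F j \<longleftrightarrow> -x \<in> uminus ` F j" for x j
      by auto
    have emb: "\<omega> \<in> ?emb (Pi\<^sub>E J X) \<longleftrightarrow> \<omega> \<in> space coin_space \<and> (\<forall>j\<in>J. \<omega> j \<in> X j)" for \<omega> X
      by (simp add: prod_emb_def coin_space_def space_PiM PiE_iff conj_commute)
    have "flip n \<omega> j \<in> F j \<longleftrightarrow> \<omega> j \<in> G j" for \<omega> j
      using mem[of "- \<omega> n" n] by (simp add: G_def flip_def)
    then have preimage: "flip n -` ?emb (Pi\<^sub>E J F) \<inter> space coin_space = ?emb (Pi\<^sub>E J G)"
      using flip_in_space by (auto simp: emb)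
    have "emeasure (distr coin_space coin_space (flip n)) (?emb (Pi\<^sub>E J F))
        = emeasure coin_space (?emb (Pi\<^sub>E J G))"
      using J F by (subst emeasure_distr) (auto simp: coin_space_def preimage[unfolded coin_space_def]
          measurable_flip[unfolded coin_space_def])
    also have "\<dots> = (\<Prod>j\<in>J. emeasure (uniform_count_measure {-1, 1}) (G j))"
      unfolding coin_space_def using J G by (intro coin.emeasure_PiM_emb) auto
    also have "\<dots> = (\<Prod>j\<in>J. emeasure (uniform_count_measure {-1, 1}) (F j))"
    proof (intro prod.cong refl)
      fix j assume "j \<in> J"
      then show "emeasure (uniform_count_measure {-1, 1}) (G j) = emeasure (uniform_count_measure {-1, 1}) (F j)"
        using F[of j] G[of j]
        by (simp add: emeasure_uniform_count_measure sets_uniform_count_measure)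
           (simp add: G_def card_image)
    qed
    finally show "emeasure (distr coin_space coin_space (flip n)) (?emb (Pi\<^sub>E J F))
        = (\<Prod>j\<in>J. emeasure (uniform_count_measure {-1, 1}) (F j))" .
  qed
  then show ?thesis
    by (simp add: coin_space_def)
qed

lemma integral_flip:
  fixes f :: "(nat \<Rightarrow> real) \<Rightarrow> real"
  assumes "f \<in> borel_measurable coin_space"
  shows "(\<integral>\<omega>. f (flip n \<omega>) \<partial>coin_space) = (\<integral>\<omega>. f \<omega> \<partial>coin_space)"
  using integral_distr[OF measurable_flip assms, of n] by (simp add: distr_flip)

lemma nn_integral_flip:
  assumes "f \<in> borel_measurable coin_space"
  shows "(\<integral>\<^sup>+\<omega>. f (flip n \<omega>) \<partial>coin_space) = (\<integral>\<^sup>+\<omega>. f \<omega> \<partial>coin_space)"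
  using nn_integral_distr[OF measurable_flip, of f n] assms by (simp add: distr_flip)

text \<open>
  This symmetry replaces independence throughout: every orthogonality relation below comes from a
  function that changes sign with one coin.
\<close>

lemma integral_eq_0_if_flip_odd:
  fixes f :: "(nat \<Rightarrow> real) \<Rightarrow> real"
  assumes "f \<in> borel_measurable coin_space"
    and "\<And>\<omega>. \<omega> \<in> space coin_space \<Longrightarrow> f (flip n \<omega>) = - f \<omega>"
  shows "(\<integral>\<omega>. f \<omega> \<partial>coin_space) = 0"
proof -
  have "(\<integral>\<omega>. f \<omega> \<partial>coin_space) = (\<integral>\<omega>. - f \<omega> \<partial>coin_space)"
    using integral_flip[OF assms(1), of n] assms(2)
    by (simp cong: Bochner_Integration.integral_cong)
  then show ?thesis
    by simp
qed

section \<open>Functions of the first signs\<close>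

text \<open>
  Only points of the space are compared, because a set in the product \<open>\<sigma>\<close>-algebra is contained
  in the space: its indicator can change between a sign sequence and a function that agrees with it
  on the first coordinates but takes other values later.
\<close>

definition determined_before :: "nat \<Rightarrow> ((nat \<Rightarrow> real) \<Rightarrow> 'b) \<Rightarrow> bool" where
  "determined_before n f \<longleftrightarrow>
     (\<forall>\<omega>\<in>space coin_space. \<forall>\<omega>'\<in>space coin_space. (\<forall>i<n. \<omega> i = \<omega>' i) \<longrightarrow> f \<omega> = f \<omega>')"

lemma determined_before_mono: "determined_before m f \<Longrightarrow> m \<le> n \<Longrightarrow> determined_before n f"
  unfolding determined_before_def by (meson less_le_trans)

lemma determined_before_sign: "k < n \<Longrightarrow> determined_before n (\<lambda>\<omega>. \<omega> k)"
  by (auto simp: determined_before_def)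

lemma determined_before_const: "determined_before n (\<lambda>\<omega>. c)"
  by (auto simp: determined_before_def)

lemma determined_before_comp: "determined_before n f \<Longrightarrow> determined_before n (\<lambda>\<omega>. g (f \<omega>))"
  unfolding determined_before_def by metis

lemma determined_before_comp2:
  "determined_before n f \<Longrightarrow> determined_before n f' \<Longrightarrow> determined_before n (\<lambda>\<omega>. g (f \<omega>) (f' \<omega>))"
  unfolding determined_before_def by metis

lemma determined_before_flip:
  assumes "determined_before n f" "n \<le> k" "\<omega> \<in> space coin_space"
  shows "f (flip k \<omega>) = f \<omega>"
proof -
  have "\<forall>i<n. flip k \<omega> i = \<omega> i"
    using assms(2) by (auto simp: flip_def)
  then show ?thesis
    using assms flip_in_space[OF assms(3)] unfolding determined_before_def by blast
qed

text \<open>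
  This \<open>\<sigma>\<close>-algebra is described by what its sets depend on and not by generators. Then
  \<open>sets_past\<close> gives all of its members, and the vanishing of a conditional expectation given the
  past can be tested on them with \<open>flip\<close>.
\<close>

definition past :: "nat \<Rightarrow> (nat \<Rightarrow> real) measure" where
  "past n = sigma (space coin_space) {B \<in> sets coin_space. determined_before n (\<lambda>\<omega>. \<omega> \<in> B)}"

lemma space_past: "space (past n) = space coin_space"
  unfolding past_def by (rule space_measure_of) (auto dest: sets.sets_into_space)

lemma sets_past: "sets (past n) = {B \<in> sets coin_space. determined_before n (\<lambda>\<omega>. \<omega> \<in> B)}"
proof -
  have "sigma_algebra (space coin_space) {B \<in> sets coin_space. determined_before n (\<lambda>\<omega>. \<omega> \<in> B)}"
  proof (unfold sigma_algebra_iff2, intro conjI ballI allI impI)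
    show "{B \<in> sets coin_space. determined_before n (\<lambda>\<omega>. \<omega> \<in> B)} \<subseteq> Pow (space coin_space)"
      by (auto dest: sets.sets_into_space)
    show "{} \<in> {B \<in> sets coin_space. determined_before n (\<lambda>\<omega>. \<omega> \<in> B)}"
      by (simp add: determined_before_const)
  next
    fix B assume B: "B \<in> {B \<in> sets coin_space. determined_before n (\<lambda>\<omega>. \<omega> \<in> B)}"
    then have "determined_before n (\<lambda>\<omega>. \<omega> \<in> space coin_space - B)"
      unfolding determined_before_def by blast
    with B show "space coin_space - B \<in> {B \<in> sets coin_space. determined_before n (\<lambda>\<omega>. \<omega> \<in> B)}"
      by blast
  next
    fix B :: "nat \<Rightarrow> (nat \<Rightarrow> real) set"
    assume "range B \<subseteq> {B \<in> sets coin_space. determined_before n (\<lambda>\<omega>. \<omega> \<in> B)}"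
    then have B: "B i \<in> sets coin_space" "determined_before n (\<lambda>\<omega>. \<omega> \<in> B i)" for i
      by auto
    have "determined_before n (\<lambda>\<omega>. \<omega> \<in> (\<Union>i. B i))"
      using B(2) unfolding determined_before_def by blast
    with B(1) show "(\<Union>i. B i) \<in> {B \<in> sets coin_space. determined_before n (\<lambda>\<omega>. \<omega> \<in> B)}"
      by auto
  qed
  then show ?thesis
    unfolding past_def by (rule sigma_algebra.sets_measure_of_eq)
qed

lemma measurable_past:
  fixes f :: "(nat \<Rightarrow> real) \<Rightarrow> real"
  assumes "f \<in> borel_measurable coin_space" "determined_before n f"
  shows "f \<in> borel_measurable (past n)"
proof (rule measurableI)
  fix A :: "real set" assume "A \<in> sets borel"
  then have "f -` A \<inter> space coin_space \<in> sets coin_space"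
    using assms(1) by (rule measurable_sets[rotated])
  moreover have "determined_before n (\<lambda>\<omega>. \<omega> \<in> f -` A \<inter> space coin_space)"
    using determined_before_comp[OF assms(2), of "\<lambda>x. x \<in> A"] unfolding determined_before_def by blast
  ultimately show "f -` A \<inter> space (past n) \<in> sets (past n)"
    by (simp add: space_past sets_past)
qed simp

lemma subalgebra_past: "subalgebra coin_space (past n)"
  by (auto simp: subalgebra_def space_past sets_past)

text \<open>
  The left-hand side is the exponential moment of a fair sign times \<open>x\<close>. The bound is the
  convexity estimate behind Hoeffding's lemma, applied to a Bernoulli variable of parameter
  \<open>1 / 2\<close> and the exponent \<open>2 * \<bar>x\<bar>\<close>.
\<close>

lemma cosh_le_exp_half_square: "cosh x \<le> exp (x\<^sup>2 / 2)" for x :: real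
proof -
  define y where "y = \<bar>x\<bar>"
  have pos: "(1 + exp (2 * y)) / 2 > 0"
    by (simp add: add_pos_pos)
  have "cosh x = cosh y"
    by (simp add: y_def)
  also have "\<dots> = exp (- y + ln ((1 + exp (2 * y)) / 2))"
  proof -
    have "exp (- y + ln ((1 + exp (2 * y)) / 2)) = exp (- y) * ((1 + exp (2 * y)) / 2)"
      using pos by (simp only: exp_add exp_ln)
    also have "\<dots> = (exp (- y) + exp (- y) * exp (2 * y)) / 2"
      by (simp add: distrib_left)
    also have "exp (- y) * exp (2 * y) = exp y"
      by (simp flip: exp_add)
    finally show ?thesis
      by (simp add: cosh_def)
  qed
  also have "\<dots> \<le> exp ((2 * y)\<^sup>2 / 8)"
    using Hoeffdings_lemma_aux[of "2 * y" "1/2"] by (simp add: y_def field_simps)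
  also have "(2 * y)\<^sup>2 / 8 = x\<^sup>2 / 2"
    by (simp add: y_def power_mult_distrib)
  finally show ?thesis .
qed

section \<open>From exponential moments to square-exponential moments\<close>

lemma nn_integral_normal_density:
  assumes "\<sigma> > 0"
  shows "(\<integral>\<^sup>+g. ennreal (normal_density \<mu> \<sigma> g) \<partial>lborel) = 1"
  using assms by (simp add: nn_integral_eq_integral)

lemma gaussian_exp_moment:
  "(\<integral>\<^sup>+g. ennreal (std_normal_density g * exp (c * g)) \<partial>lborel) = ennreal (exp (c\<^sup>2 / 2))"
proof -
  have "std_normal_density g * exp (c * g) = exp (c\<^sup>2 / 2) * normal_density c 1 g" for g
  proof -
    have "- g\<^sup>2 / 2 + c * g = c\<^sup>2 / 2 + - (g - c)\<^sup>2 / 2"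
      by (simp add: power2_eq_square field_simps)
    then have "exp (- g\<^sup>2 / 2) * exp (c * g) = exp (c\<^sup>2 / 2) * exp (- (g - c)\<^sup>2 / 2)"
      by (simp only: exp_add[symmetric])
    then show ?thesis
      by (simp add: normal_density_def)
  qed
  then have "(\<integral>\<^sup>+g. ennreal (std_normal_density g * exp (c * g)) \<partial>lborel)
      = (\<integral>\<^sup>+g. ennreal (exp (c\<^sup>2 / 2)) * ennreal (normal_density c 1 g) \<partial>lborel)"
    by (simp add: ennreal_mult)
  also have "\<dots> = ennreal (exp (c\<^sup>2 / 2))"
    by (simp add: nn_integral_cmult nn_integral_normal_density)
  finally show ?thesis .
qed

lemma gaussian_square_exp_moment:
  "(\<integral>\<^sup>+g. ennreal (std_normal_density g * exp (g\<^sup>2 / 4)) \<partial>lborel) = ennreal (sqrt 2)"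
proof -
  have "std_normal_density g * exp (g\<^sup>2 / 4) = sqrt 2 * normal_density 0 (sqrt 2) g" for g
  proof -
    have "exp (- g\<^sup>2 / 2) * exp (g\<^sup>2 / 4) = exp (- g\<^sup>2 / 4)"
      by (simp add: exp_add[symmetric])
    moreover have "1 / sqrt (2 * pi) = sqrt 2 * (1 / sqrt (4 * pi))"
      by (simp add: real_sqrt_mult field_simps)
    ultimately show ?thesis
      by (simp add: normal_density_def real_sqrt_mult)
  qed
  then have "(\<integral>\<^sup>+g. ennreal (std_normal_density g * exp (g\<^sup>2 / 4)) \<partial>lborel)
      = (\<integral>\<^sup>+g. ennreal (sqrt 2) * ennreal (normal_density 0 (sqrt 2) g) \<partial>lborel)"
    by (simp add: ennreal_mult)
  also have "\<dots> = ennreal (sqrt 2)"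
    by (simp add: nn_integral_cmult nn_integral_normal_density)
  finally show ?thesis .
qed

text \<open>
  The square is linearised by an auxiliary standard Gaussian variable \<open>g\<close>: for
  \<open>c = u / (s * sqrt 2)\<close>, the number \<open>exp (u\<^sup>2 / (4 * s\<^sup>2)) = exp (c\<^sup>2 / 2)\<close> is the expectation of
  \<open>exp (c * g)\<close>. Exchanging the two integrals leaves, for each value of \<open>g\<close>, an exponential moment
  of \<open>u\<close>, which is at most \<open>exp (g\<^sup>2 / 4)\<close>; the Gaussian integral of that is \<open>sqrt 2\<close>.
\<close>

lemma (in prob_space) square_exp_moment_le:
  fixes u :: "'a \<Rightarrow> real"
  assumes [measurable]: "u \<in> borel_measurable M" and "s > 0"
    and exp_moment: "\<And>t. (\<integral>\<^sup>+\<omega>. ennreal (exp (t * u \<omega>)) \<partial>M) \<le> ennreal (exp (s\<^sup>2 * t\<^sup>2 / 2))"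
  shows "(\<integral>\<^sup>+\<omega>. ennreal (exp ((u \<omega>)\<^sup>2 / (4 * s\<^sup>2))) \<partial>M) \<le> ennreal (sqrt 2)"
proof -
  interpret pair_sigma_finite M lborel ..
  define r where "r = 1 / (s * sqrt 2)"
  have r: "r\<^sup>2 = 1 / (2 * s\<^sup>2)"
    by (simp add: r_def power_divide power_mult_distrib)
  have "(\<integral>\<^sup>+\<omega>. ennreal (exp ((u \<omega>)\<^sup>2 / (4 * s\<^sup>2))) \<partial>M)
      = (\<integral>\<^sup>+\<omega>. (\<integral>\<^sup>+g. ennreal (std_normal_density g * exp ((r * u \<omega>) * g)) \<partial>lborel) \<partial>M)"
    by (simp add: gaussian_exp_moment power_mult_distrib r)
  also have "\<dots> = (\<integral>\<^sup>+g. (\<integral>\<^sup>+\<omega>. ennreal (std_normal_density g * exp ((r * u \<omega>) * g)) \<partial>M) \<partial>lborel)"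
    by (rule Fubini'[symmetric]) measurable
  also have "\<dots> = (\<integral>\<^sup>+g. ennreal (std_normal_density g) * (\<integral>\<^sup>+\<omega>. ennreal (exp ((r * g) * u \<omega>)) \<partial>M) \<partial>lborel)"
    by (simp add: ennreal_mult nn_integral_cmult mult_ac)
  also have "\<dots> \<le> (\<integral>\<^sup>+g. ennreal (std_normal_density g) * ennreal (exp (s\<^sup>2 * (r * g)\<^sup>2 / 2)) \<partial>lborel)"
    by (intro nn_integral_mono mult_left_mono exp_moment) simp
  also have "\<dots> = (\<integral>\<^sup>+g. ennreal (std_normal_density g * exp (g\<^sup>2 / 4)) \<partial>lborel)"
    using \<open>s > 0\<close> by (simp add: ennreal_mult power_mult_distrib r)
  also have "\<dots> = ennreal (sqrt 2)"
    by (rule gaussian_square_exp_moment)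
  finally show ?thesis .
qed

section \<open>Sidon bounds of orthonormal systems\<close>

text \<open>
  Lets the sup norms below, which are extended reals, be treated as nonnegative real numbers.
\<close>

lemma Linf_norm_bounded:
  assumes "prob_space M" and [measurable]: "f \<in> borel_measurable M"
    and bound: "\<And>\<omega>. \<omega> \<in> space M \<Longrightarrow> cmod (f \<omega>) \<le> B"
  obtains l where "Linf_norm M f = ereal l" "0 \<le> l" "l \<le> B"
proof -
  interpret prob_space M by fact
  have "esssup M (\<lambda>_. 0::ereal) \<le> Linf_norm M f"
    unfolding Linf_norm_def by (rule esssup_mono) auto
  moreover have "Linf_norm M f \<le> ereal B"
    unfolding Linf_norm_def by (rule esssup_I) (auto intro!: AE_I2 bound)
  ultimately show thesis
    using that by (cases "Linf_norm M f") (auto simp: esssup_const emeasure_space_1)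
qed

text \<open>
  Testing a Sidon bound with all coefficients equal to 1 turns a uniformly small sum of the
  functions into a lower bound for the constant.
\<close>

lemma sidon_bound_card_le:
  assumes "prob_space M" "finite F" "sidon_bound M \<phi> F c"
    and [measurable]: "\<And>k. k \<in> F \<Longrightarrow> \<phi> k \<in> borel_measurable M"
    and bound: "\<And>\<omega>. \<omega> \<in> space M \<Longrightarrow> cmod (\<Sum>k\<in>F. \<phi> k \<omega>) \<le> B"
    and "F \<noteq> {}"
  shows "real (card F) \<le> c * B"
proof -
  obtain l where l: "Linf_norm M (\<lambda>\<omega>. \<Sum>k\<in>F. \<phi> k \<omega>) = ereal l" "0 \<le> l" "l \<le> B"
    by (rule Linf_norm_bounded[OF assms(1) _ bound]) auto
  have card: "real (card F) \<le> c * l"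
    using assms(3)[unfolded sidon_bound_def, rule_format, of "\<lambda>_. 1"] l(1) by simp
  moreover have "real (card F) > 0"
    using assms by (simp add: card_gt_0_iff)
  ultimately have "c > 0"
    using l(2) by (smt (verit) mult_nonpos_nonneg)
  then have "c * l \<le> c * B"
    using l(3) by simp
  with card show ?thesis
    by linarith
qed

text \<open>
  By orthonormality, \<open>x k\<close> is the integral of the sum against \<open>\<phi> k\<close>, and \<open>\<bar>\<phi> k\<bar> \<le> b\<close>.
\<close>

lemma coefficient_le_Linf_norm:
  assumes "prob_space M" and F: "finite F" "k \<in> F" and orth: "orthonormal_system M \<phi> F"
    and bound: "\<And>k \<omega>. k \<in> F \<Longrightarrow> \<omega> \<in> space M \<Longrightarrow> \<bar>\<phi> k \<omega>\<bar> \<le> b"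
  shows "ereal (cmod (x k)) \<le> ereal b * Linf_norm M (\<lambda>\<omega>. \<Sum>j\<in>F. x j * complex_of_real (\<phi> j \<omega>))"
    (is "_ \<le> _ * Linf_norm M ?f")
proof -
  interpret prob_space M by fact
  have [measurable]: "\<phi> j \<in> borel_measurable M" if "j \<in> F" for j
    using orth that by (auto simp: orthonormal_system_def)
  have f_meas [measurable]: "?f \<in> borel_measurable M"
    by measurable
  have b0: "b \<ge> 0"
    using bound[OF F(2)] not_empty by (meson abs_ge_zero ex_in_conv order_trans)
  have int: "integrable M (\<lambda>\<omega>. \<phi> i \<omega> * \<phi> j \<omega>)" if "i \<in> F" "j \<in> F" for i j
  proof (rule integrable_const_bound[where B = "b * b"])
    show "AE \<omega> in M. norm (\<phi> i \<omega> * \<phi> j \<omega>) \<le> b * b"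
      using that bound b0 by (auto intro!: AE_I2 mult_mono simp: abs_mult)
  qed (use that in measurable)
  have expand: "?f \<omega> * complex_of_real (\<phi> k \<omega>)
      = (\<Sum>j\<in>F. x j * complex_of_real (\<phi> j \<omega> * \<phi> k \<omega>))" for \<omega>
    by (simp add: sum_distrib_right mult.assoc)
  have "(\<integral>\<omega>. ?f \<omega> * complex_of_real (\<phi> k \<omega>) \<partial>M)
      = (\<Sum>j\<in>F. (\<integral>\<omega>. x j * complex_of_real (\<phi> j \<omega> * \<phi> k \<omega>) \<partial>M))"
    unfolding expand using int F(2)
    by (intro Bochner_Integration.integral_sum integrable_mult_right integrable_of_real)
  also have "\<dots> = (\<Sum>j\<in>F. if j = k then x k else 0)"
    using orth F(2) unfolding orthonormal_system_def
    by (intro sum.cong refl) (simp del: of_real_mult)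
  also have "\<dots> = x k"
    using F by simp
  finally have coeff: "(\<integral>\<omega>. ?f \<omega> * complex_of_real (\<phi> k \<omega>) \<partial>M) = x k" .
  obtain l where l: "Linf_norm M ?f = ereal l" "0 \<le> l"
  proof (rule Linf_norm_bounded[OF assms(1) f_meas])
    show "cmod (?f \<omega>) \<le> (\<Sum>j\<in>F. cmod (x j) * b)" if "\<omega> \<in> space M" for \<omega>
      using bound that by (intro sum_norm_le) (simp add: norm_mult mult_left_mono)
  qed
  have AE_l: "AE \<omega> in M. cmod (?f \<omega>) \<le> l"
    using esssup_AE[of "\<lambda>\<omega>. ereal (cmod (?f \<omega>))" M] l(1) by (simp add: Linf_norm_def)
  have "cmod (x k) \<le> (\<integral>\<omega>. cmod (?f \<omega> * complex_of_real (\<phi> k \<omega>)) \<partial>M)"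
    unfolding coeff[symmetric] by (rule integral_norm_bound)
  also have "\<dots> \<le> (\<integral>\<omega>. b * l \<partial>M)"
  proof (rule integral_mono_AE')
    show "AE \<omega> in M. cmod (?f \<omega> * complex_of_real (\<phi> k \<omega>)) \<le> b * l"
      using AE_l AE_space
    proof eventually_elim
      case (elim \<omega>)
      then show ?case
        using bound[OF F(2), of \<omega>] b0 l(2) by (auto simp: norm_mult mult.commute[of b] intro!: mult_mono)
    qed
    show "AE \<omega> in M. 0 \<le> b * l"
      using b0 l(2) by simp
  qed simp
  also have "\<dots> = b * l"
    by (simp add: prob_space)
  finally show ?thesis
    by (simp add: l(1))
qed

text \<open>
  For a finite orthonormal system the admissible constants form a nonempty set, as
  \<open>card F * b\<close> is one of them by the previous lemma. They are bounded below by 0. For each choice of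
  coefficients the Sidon inequality is a non-strict condition on the constant, so it passes to the
  infimum.
\<close>

lemma ex_smallest_sidon_bound:
  assumes "prob_space M" and F: "finite F" "F \<noteq> {}" and orth: "orthonormal_system M \<phi> F"
    and bound: "\<And>k \<omega>. k \<in> F \<Longrightarrow> \<omega> \<in> space M \<Longrightarrow> \<bar>\<phi> k \<omega>\<bar> \<le> b"
  shows "\<exists>C. is_smallest {c. sidon_bound M (\<lambda>k \<omega>. complex_of_real (\<phi> k \<omega>)) F c} C"
proof -
  interpret prob_space M by fact
  let ?\<phi> = "\<lambda>k \<omega>. complex_of_real (\<phi> k \<omega>)"
  define S where "S = {c. sidon_bound M ?\<phi> F c}"
  have [measurable]: "\<phi> j \<in> borel_measurable M" if "j \<in> F" for j
    using orth that by (auto simp: orthonormal_system_def)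
  have b0: "b \<ge> 0"
    using F bound not_empty by (meson abs_ge_zero ex_in_conv order_trans)
  let ?L = "\<lambda>x. Linf_norm M (\<lambda>\<omega>. \<Sum>j\<in>F. x j * ?\<phi> j \<omega>)"
  have fin: "\<exists>l\<ge>0. ?L x = ereal l" for x
  proof (rule Linf_norm_bounded[OF assms(1)])
    show "cmod (\<Sum>j\<in>F. x j * ?\<phi> j \<omega>) \<le> (\<Sum>j\<in>F. cmod (x j) * b)" if "\<omega> \<in> space M" for \<omega>
      using bound that by (intro sum_norm_le) (simp add: norm_mult mult_left_mono)
  qed auto
  have "real (card F) * b \<in> S"
    unfolding S_def sidon_bound_def mem_Collect_eq
  proof
    fix x :: "nat \<Rightarrow> complex"
    obtain l where l: "?L x = ereal l" "l \<ge> 0"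
      using fin by blast
    have "cmod (x k) \<le> b * l" if "k \<in> F" for k
      using coefficient_le_Linf_norm[OF assms(1) F(1) that orth bound, of x] l by simp
    then have "(\<Sum>k\<in>F. cmod (x k)) \<le> real (card F) * (b * l)"
      by (rule sum_bounded_above)
    then show "ereal (\<Sum>k\<in>F. cmod (x k)) \<le> ereal (real (card F) * b) * ?L x"
      by (simp add: l mult.assoc)
  qed
  then have ne: "S \<noteq> {}"
    by auto
  have pos: "c \<ge> 0" if "c \<in> S" for c
  proof (rule ccontr)
    assume "\<not> c \<ge> 0"
    obtain l where l: "?L (\<lambda>_. 1) = ereal l" "l \<ge> 0"
      using fin[of "\<lambda>_. 1"] by auto
    have "real (card F) \<le> c * l"
      using that[unfolded S_def sidon_bound_def mem_Collect_eq, rule_format, of "\<lambda>_. 1"] l by simp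
    moreover have "card F > 0"
      using F by (simp add: card_gt_0_iff)
    moreover have "c * l \<le> 0"
      using \<open>\<not> c \<ge> 0\<close> l(2) by (simp add: mult_le_0_iff)
    ultimately show False
      by simp
  qed
  then have bdd: "bdd_below S"
    by (meson bdd_belowI)
  have "sidon_bound M ?\<phi> F (Inf S)"
    unfolding sidon_bound_def
  proof
    fix x :: "nat \<Rightarrow> complex"
    obtain l where l: "?L x = ereal l" "l \<ge> 0"
      using fin by blast
    have le: "(\<Sum>k\<in>F. cmod (x k)) \<le> c * l" if "c \<in> S" for c
      using that[unfolded S_def sidon_bound_def mem_Collect_eq, rule_format, of x] l by simp
    have "(\<Sum>k\<in>F. cmod (x k)) \<le> Inf S * l"
    proof (cases "l = 0")
      case True
      then show ?thesis
        using le ne by auto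
    next
      case False
      then have "l > 0"
        using l by simp
      then have "(\<Sum>k\<in>F. cmod (x k)) / l \<le> Inf S"
        using le ne by (intro cInf_greatest) (auto simp: divide_le_eq)
      then show ?thesis
        using \<open>l > 0\<close> by (simp add: divide_le_eq)
    qed
    then show "ereal (\<Sum>k\<in>F. cmod (x k)) \<le> ereal (Inf S) * ?L x"
      by (simp add: l)
  qed
  then have "is_smallest S (Inf S)"
    using bdd by (auto simp: is_smallest_def S_def intro: cInf_lower)
  then show ?thesis
    unfolding S_def by blast
qed

section \<open>Gated signs\<close>

text \<open>
  A martingale difference sequence in which the \<open>n\<close>-th coin is multiplied by a gate that is decided
  by the earlier coins. Whatever the gates are, given the past the \<open>n\<close>-th function takes two
  opposite values of modulus at most \<open>b\<close> with equal probability. This gives orthogonality, the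
  martingale property and the subgaussian estimates; the gates are left free to shape the sums.
\<close>

locale gated_signs =
  fixes h :: "nat \<Rightarrow> (nat \<Rightarrow> real) \<Rightarrow> real" and b :: real
  assumes gate_measurable [measurable]: "\<And>n. h n \<in> borel_measurable coin_space"
    and gate_determined: "\<And>n. determined_before n (h n)"
    and gate_bounded: "\<And>n \<omega>. \<omega> \<in> space coin_space \<Longrightarrow> \<bar>h n \<omega>\<bar> \<le> b"
begin

definition \<phi> :: "nat \<Rightarrow> (nat \<Rightarrow> real) \<Rightarrow> real" where
  "\<phi> n \<omega> = \<omega> n * h n \<omega>"

lemma phi_measurable [measurable]: "\<phi> n \<in> borel_measurable coin_space"
  unfolding \<phi>_def by measurable

lemma phi_determined: "k < n \<Longrightarrow> determined_before n (\<phi> k)"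
  unfolding \<phi>_def
  by (rule determined_before_comp2[OF determined_before_sign determined_before_mono[OF gate_determined]]) auto

lemma phi_bounded: "\<omega> \<in> space coin_space \<Longrightarrow> \<bar>\<phi> n \<omega>\<bar> \<le> b"
  by (simp add: \<phi>_def abs_mult gate_bounded)

lemma phi_squared: "\<omega> \<in> space coin_space \<Longrightarrow> (\<phi> n \<omega>)\<^sup>2 = (h n \<omega>)\<^sup>2"
  by (simp add: \<phi>_def power_mult_distrib)

lemma phi_flip: "\<omega> \<in> space coin_space \<Longrightarrow> \<phi> n (flip n \<omega>) = - \<phi> n \<omega>"
  using determined_before_flip[OF gate_determined, of n n \<omega>] by (simp add: \<phi>_def) (simp add: flip_def)

lemma bound_nonneg: "0 \<le> b"
proof -
  obtain \<omega> where "\<omega> \<in> space coin_space"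
    using coin_space.not_empty by blast
  from gate_bounded[OF this, of 0] show ?thesis
    by linarith
qed

text \<open>
  Flipping the \<open>n\<close>-th coin fixes \<open>f\<close> and the gate and reverses \<open>\<phi> n\<close>.
\<close>

lemma integral_past_times_phi:
  fixes f :: "(nat \<Rightarrow> real) \<Rightarrow> real"
  assumes [measurable]: "f \<in> borel_measurable coin_space" and "determined_before n f"
  shows "(\<integral>\<omega>. f \<omega> * \<phi> n \<omega> \<partial>coin_space) = 0"
proof (rule integral_eq_0_if_flip_odd[of _ n])
  show "f (flip n \<omega>) * \<phi> n (flip n \<omega>) = - (f \<omega> * \<phi> n \<omega>)" if "\<omega> \<in> space coin_space" for \<omega>
    using determined_before_flip[OF assms(2) order_refl that] that by (simp add: phi_flip)
qed measurable

lemma integrable_phi_times_phi: "integrable coin_space (\<lambda>\<omega>. \<phi> m \<omega> * \<phi> n \<omega>)"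
proof (rule coin_space.integrable_const_bound[where B = "b * b"])
  show "AE \<omega> in coin_space. norm (\<phi> m \<omega> * \<phi> n \<omega>) \<le> b * b"
    using phi_bounded bound_nonneg by (auto intro!: AE_I2 mult_mono simp: abs_mult)
qed measurable

lemma integral_phi_times_phi:
  assumes "m \<noteq> n"
  shows "(\<integral>\<omega>. \<phi> m \<omega> * \<phi> n \<omega> \<partial>coin_space) = 0"
proof -
  have *: "(\<integral>\<omega>. \<phi> m \<omega> * \<phi> n \<omega> \<partial>coin_space) = 0" if "m < n" for m n
    using that by (intro integral_past_times_phi phi_determined) auto
  show ?thesis
    using *[of m n] *[of n m] assms by (cases m n rule: linorder_cases) (auto simp: mult.commute)
qed

lemma orthonormal:
  assumes "\<And>n. n \<in> I \<Longrightarrow> (\<integral>\<omega>. (h n \<omega>)\<^sup>2 \<partial>coin_space) = 1"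
  shows "orthonormal_system coin_space \<phi> I"
  unfolding orthonormal_system_def
proof (intro conjI ballI)
  fix n assume "n \<in> I"
  show "integrable coin_space (\<lambda>\<omega>. (\<phi> n \<omega>)\<^sup>2)"
    using integrable_phi_times_phi[of n n] by (simp add: power2_eq_square)
  fix m assume "m \<in> I"
  have "(\<integral>\<omega>. \<phi> n \<omega> * \<phi> n \<omega> \<partial>coin_space) = (\<integral>\<omega>. (h n \<omega>)\<^sup>2 \<partial>coin_space)"
    by (intro Bochner_Integration.integral_cong refl) (simp add: power2_eq_square[symmetric] phi_squared)
  then show "(\<integral>\<omega>. \<phi> m \<omega> * \<phi> n \<omega> \<partial>coin_space) = (if m = n then 1 else 0)"
    using assms[OF \<open>n \<in> I\<close>] by (simp add: integral_phi_times_phi)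
qed measurable

lemma martingale_difference: "martingale_difference coin_space \<phi>"
  unfolding martingale_difference_def
proof (intro exI[of _ "\<lambda>n. past (Suc n)"] conjI allI impI)
  show "filtration (space coin_space) (\<lambda>n. past (Suc n))"
  proof
    show "sets (past (Suc i)) \<le> sets (past (Suc j))" if "i \<le> j" for i j
      using that by (auto simp: sets_past intro: determined_before_mono)
  qed (rule space_past)
  fix n :: nat
  show "subalgebra coin_space (past (Suc n))"
    by (rule subalgebra_past)
  show int: "integrable coin_space (\<phi> n)"
    using phi_bounded[of _ n] by (intro coin_space.integrable_const_bound[where B = b] AE_I2) auto
  show "\<phi> n \<in> borel_measurable (past (Suc n))"
    by (intro measurable_past phi_determined) auto
  assume "1 \<le> n"
  interpret past: finite_measure_subalgebra coin_space "past n"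
    by standard (rule subalgebra_past)
  have "AE \<omega> in coin_space. real_cond_exp coin_space (past n) (\<phi> n) \<omega> = (\<lambda>_. 0) \<omega>"
  proof (rule past.real_cond_exp_charact)
    fix A assume "A \<in> sets (past n)"
    then have A: "A \<in> sets coin_space" "determined_before n (\<lambda>\<omega>. \<omega> \<in> A)"
      by (auto simp: sets_past)
    have "determined_before n (\<lambda>\<omega>. indicator A \<omega> :: real)"
      using determined_before_comp[OF A(2), of "of_bool :: bool \<Rightarrow> real"] by (simp add: indicator_def)
    then show "(\<integral>\<omega>\<in>A. \<phi> n \<omega> \<partial>coin_space) = (\<integral>\<omega>\<in>A. 0 \<partial>coin_space)"
      using integral_past_times_phi[of "indicator A" n] A(1) by (simp add: set_lebesgue_integral_def)
  qed (use int in auto)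
  then show "AE \<omega> in coin_space. real_cond_exp coin_space (past (Suc (n - 1))) (\<phi> n) \<omega> = 0"
    using \<open>1 \<le> n\<close> by simp
qed

text \<open>
  Averaging the integrand with its image under \<open>flip n\<close> replaces \<open>exp (x * \<phi> n \<omega>)\<close> by
  \<open>cosh (x * \<phi> n \<omega>)\<close>, which is bounded by a constant. It is stated with nonnegative integrals, so
  that no integrability has to be established first.
\<close>

lemma exp_moment_step:
  assumes [measurable]: "f \<in> borel_measurable coin_space" and det: "determined_before n f"
  shows "(\<integral>\<^sup>+\<omega>. ennreal (exp (f \<omega> + x * \<phi> n \<omega>)) \<partial>coin_space)
    \<le> ennreal (exp (b\<^sup>2 * x\<^sup>2 / 2)) * (\<integral>\<^sup>+\<omega>. ennreal (exp (f \<omega>)) \<partial>coin_space)" (is "?I \<le> ?R")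
proof -
  \<comment> \<open>Doubling avoids a division of extended nonnegative reals.\<close>
  have "?I = (\<integral>\<^sup>+\<omega>. ennreal (exp (f (flip n \<omega>) + x * \<phi> n (flip n \<omega>))) \<partial>coin_space)"
    by (rule nn_integral_flip[symmetric]) measurable
  also have "\<dots> = (\<integral>\<^sup>+\<omega>. ennreal (exp (f \<omega> - x * \<phi> n \<omega>)) \<partial>coin_space)"
    using determined_before_flip[OF det order_refl]
    by (intro nn_integral_cong) (simp add: phi_flip)
  finally have "2 * ?I = ?I + (\<integral>\<^sup>+\<omega>. ennreal (exp (f \<omega> - x * \<phi> n \<omega>)) \<partial>coin_space)"
    by (simp add: mult_2)
  also have "\<dots> = (\<integral>\<^sup>+\<omega>. ennreal (exp (f \<omega> + x * \<phi> n \<omega>)) + ennreal (exp (f \<omega> - x * \<phi> n \<omega>)) \<partial>coin_space)"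
    by (rule nn_integral_add[symmetric]) measurable
  also have "\<dots> \<le> (\<integral>\<^sup>+\<omega>. ennreal (2 * exp (b\<^sup>2 * x\<^sup>2 / 2)) * ennreal (exp (f \<omega>)) \<partial>coin_space)"
  proof (rule nn_integral_mono)
    fix \<omega> assume \<omega>: "\<omega> \<in> space coin_space"
    have "cosh (x * \<phi> n \<omega>) \<le> exp ((x * \<phi> n \<omega>)\<^sup>2 / 2)"
      by (rule cosh_le_exp_half_square)
    also have "\<dots> \<le> exp (b\<^sup>2 * x\<^sup>2 / 2)"
      using abs_le_square_iff[of "\<phi> n \<omega>" b] phi_bounded[OF \<omega>, of n] bound_nonneg
      by (simp add: power_mult_distrib mult.commute[of "x\<^sup>2"] mult_right_mono)
    finally have "2 * cosh (x * \<phi> n \<omega>) * exp (f \<omega>) \<le> 2 * exp (b\<^sup>2 * x\<^sup>2 / 2) * exp (f \<omega>)"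
      by simp
    moreover have "exp (f \<omega> + x * \<phi> n \<omega>) + exp (f \<omega> - x * \<phi> n \<omega>) = 2 * cosh (x * \<phi> n \<omega>) * exp (f \<omega>)"
      by (simp add: cosh_def exp_add exp_diff exp_minus field_simps)
    ultimately show "ennreal (exp (f \<omega> + x * \<phi> n \<omega>)) + ennreal (exp (f \<omega> - x * \<phi> n \<omega>))
        \<le> ennreal (2 * exp (b\<^sup>2 * x\<^sup>2 / 2)) * ennreal (exp (f \<omega>))"
      by (simp add: ennreal_plus[symmetric] ennreal_mult[symmetric] del: ennreal_plus)
  qed
  also have "\<dots> = 2 * ?R"
    by (simp add: nn_integral_cmult ennreal_mult mult.assoc)
  finally show ?thesis
    by (simp add: ennreal_mult_le_mult_iff)
qed

text \<open>
  The largest index is removed first: the sum over the smaller ones is determined by the earlier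
  coins, as the previous lemma requires.
\<close>

lemma exp_moment:
  fixes x :: "nat \<Rightarrow> real"
  assumes "finite F"
  shows "(\<integral>\<^sup>+\<omega>. ennreal (exp (\<Sum>k\<in>F. x k * \<phi> k \<omega>)) \<partial>coin_space)
    \<le> ennreal (exp (b\<^sup>2 * (\<Sum>k\<in>F. (x k)\<^sup>2) / 2))"
  using assms
proof (induction F rule: finite_linorder_max_induct)
  case empty
  then show ?case
    by (simp add: coin_space.emeasure_space_1)
next
  case (insert n F)
  have n: "n \<notin> F"
    using insert.hyps by blast
  have det: "determined_before n (\<lambda>\<omega>. \<Sum>k\<in>F. x k * \<phi> k \<omega>)"
    unfolding determined_before_def
  proof (intro ballI impI sum.cong refl)
    fix \<omega> \<omega>' k assume "\<omega> \<in> space coin_space" "\<omega>' \<in> space coin_space" "\<forall>i<n. \<omega> i = \<omega>' i" "k \<in> F"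
    then show "x k * \<phi> k \<omega> = x k * \<phi> k \<omega>'"
      using phi_determined[of k n] insert.hyps unfolding determined_before_def by metis
  qed
  have "(\<integral>\<^sup>+\<omega>. ennreal (exp (\<Sum>k\<in>insert n F. x k * \<phi> k \<omega>)) \<partial>coin_space)
      = (\<integral>\<^sup>+\<omega>. ennreal (exp ((\<Sum>k\<in>F. x k * \<phi> k \<omega>) + x n * \<phi> n \<omega>)) \<partial>coin_space)"
    using insert.hyps n by (simp add: add.commute)
  also have "\<dots> \<le> ennreal (exp (b\<^sup>2 * (x n)\<^sup>2 / 2)) * (\<integral>\<^sup>+\<omega>. ennreal (exp (\<Sum>k\<in>F. x k * \<phi> k \<omega>)) \<partial>coin_space)"
    by (rule exp_moment_step[OF _ det]) measurable
  also have "\<dots> \<le> ennreal (exp (b\<^sup>2 * (x n)\<^sup>2 / 2)) * ennreal (exp (b\<^sup>2 * (\<Sum>k\<in>F. (x k)\<^sup>2) / 2))"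
    by (intro mult_left_mono insert.IH) simp
  also have "\<dots> = ennreal (exp (b\<^sup>2 * (\<Sum>k\<in>insert n F. (x k)\<^sup>2) / 2))"
    using insert.hyps n
    by (simp add: ennreal_mult[symmetric] exp_add[symmetric] add_divide_distrib distrib_left)
  finally show ?case .
qed

text \<open>
  The real and imaginary parts of a complex combination are real combinations with smaller
  coefficients. The constant \<open>\<beta> = sqrt 8 * b\<close> makes the exponent equal to \<open>p + q\<close>, where
  \<open>2 * p\<close> and \<open>2 * q\<close> are the exponents of \<open>square_exp_moment_le\<close> for the two parts, and
  \<open>exp (p + q)\<close> is at most the mean of \<open>exp (2 * p)\<close> and \<open>exp (2 * q)\<close>. Finally \<open>sqrt 2 \<le> exp 1\<close>.
\<close>

lemma subgaussian:
  assumes "b > 0"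
  shows "subgaussian coin_space (\<lambda>n \<omega>. complex_of_real (\<phi> n \<omega>)) I"
  unfolding subgaussian_def
proof (intro exI[of _ "sqrt 8 * b"] conjI allI impI)
  show "0 < sqrt 8 * b"
    using assms by simp
  fix F and x :: "nat \<Rightarrow> complex"
  assume F: "finite F \<and> F \<subseteq> I \<and> (\<Sum>k\<in>F. (cmod (x k))\<^sup>2) \<le> 1"
  have square_exp: "(\<integral>\<^sup>+\<omega>. ennreal (exp ((\<Sum>k\<in>F. a k * \<phi> k \<omega>)\<^sup>2 / (4 * b\<^sup>2))) \<partial>coin_space) \<le> ennreal (sqrt 2)"
    if a: "\<And>k. \<bar>a k\<bar> \<le> cmod (x k)" for a
  proof (rule coin_space.square_exp_moment_le[OF _ assms])
    fix t :: real
    have "(\<Sum>k\<in>F. (a k)\<^sup>2) \<le> (\<Sum>k\<in>F. (cmod (x k))\<^sup>2)"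
      using a by (intro sum_mono) (simp add: abs_le_square_iff[symmetric])
    then have "(\<Sum>k\<in>F. (a k)\<^sup>2) \<le> 1"
      using F by linarith
    then have "b\<^sup>2 * t\<^sup>2 * (\<Sum>k\<in>F. (a k)\<^sup>2) \<le> b\<^sup>2 * t\<^sup>2 * 1"
      by (intro mult_left_mono) auto
    then have le: "b\<^sup>2 * (\<Sum>k\<in>F. (t * a k)\<^sup>2) / 2 \<le> b\<^sup>2 * t\<^sup>2 / 2"
      by (simp add: power_mult_distrib sum_distrib_left[symmetric] mult.assoc)
    have "(\<integral>\<^sup>+\<omega>. ennreal (exp (t * (\<Sum>k\<in>F. a k * \<phi> k \<omega>))) \<partial>coin_space)
        = (\<integral>\<^sup>+\<omega>. ennreal (exp (\<Sum>k\<in>F. (t * a k) * \<phi> k \<omega>)) \<partial>coin_space)"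
      by (simp add: sum_distrib_left mult.assoc)
    also have "\<dots> \<le> ennreal (exp (b\<^sup>2 * (\<Sum>k\<in>F. (t * a k)\<^sup>2) / 2))"
      using F by (intro exp_moment) auto
    also have "\<dots> \<le> ennreal (exp (b\<^sup>2 * t\<^sup>2 / 2))"
      using le by (intro ennreal_leI) simp
    finally show "(\<integral>\<^sup>+\<omega>. ennreal (exp (t * (\<Sum>k\<in>F. a k * \<phi> k \<omega>))) \<partial>coin_space)
        \<le> ennreal (exp (b\<^sup>2 * t\<^sup>2 / 2))" .
  qed measurable
  let ?u = "\<lambda>\<omega>. \<Sum>k\<in>F. Re (x k) * \<phi> k \<omega>" and ?v = "\<lambda>\<omega>. \<Sum>k\<in>F. Im (x k) * \<phi> k \<omega>"
  let ?E = "\<lambda>w \<omega>. exp ((w \<omega>)\<^sup>2 / (4 * b\<^sup>2)) :: real"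
  have "(\<integral>\<^sup>+\<omega>. ennreal (exp ((cmod (\<Sum>k\<in>F. x k * complex_of_real (\<phi> k \<omega>)))\<^sup>2 / (sqrt 8 * b)\<^sup>2)) \<partial>coin_space)
      \<le> (\<integral>\<^sup>+\<omega>. ennreal (1 / 2) * (ennreal (?E ?u \<omega>) + ennreal (?E ?v \<omega>)) \<partial>coin_space)"
  proof (rule nn_integral_mono)
    fix \<omega>
    define p q where "p = (?u \<omega>)\<^sup>2 / (8 * b\<^sup>2)" and "q = (?v \<omega>)\<^sup>2 / (8 * b\<^sup>2)"
    have "(cmod (\<Sum>k\<in>F. x k * complex_of_real (\<phi> k \<omega>)))\<^sup>2 / (sqrt 8 * b)\<^sup>2 = p + q"
      by (simp add: cmod_power2 p_def q_def power_mult_distrib add_divide_distrib)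
    moreover have "exp (p + q) \<le> 1 / 2 * (exp (2 * p) + exp (2 * q))"
      using sum_squares_bound[of "exp p" "exp q"] by (simp add: exp_add exp_double power2_eq_square)
    moreover have "exp (2 * p) = ?E ?u \<omega>" "exp (2 * q) = ?E ?v \<omega>"
      by (simp_all add: p_def q_def)
    ultimately show "ennreal (exp ((cmod (\<Sum>k\<in>F. x k * complex_of_real (\<phi> k \<omega>)))\<^sup>2 / (sqrt 8 * b)\<^sup>2))
        \<le> ennreal (1 / 2) * (ennreal (?E ?u \<omega>) + ennreal (?E ?v \<omega>))"
      by (simp only: ennreal_plus[symmetric] ennreal_mult[symmetric] exp_ge_zero add_nonneg_nonneg
          zero_le_divide_1_iff zero_le_numeral ennreal_leI)
  qed
  also have "\<dots> = ennreal (1 / 2) * ((\<integral>\<^sup>+\<omega>. ennreal (?E ?u \<omega>) \<partial>coin_space) + (\<integral>\<^sup>+\<omega>. ennreal (?E ?v \<omega>) \<partial>coin_space))"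
    by (subst nn_integral_cmult; (subst nn_integral_add)?) auto
  also have "\<dots> \<le> ennreal (1 / 2) * (ennreal (sqrt 2) + ennreal (sqrt 2))"
    by (intro mult_left_mono add_mono square_exp abs_Re_le_cmod abs_Im_le_cmod) simp
  also have "\<dots> = ennreal (sqrt 2)"
    by (simp only: ennreal_plus[symmetric] ennreal_mult[symmetric] real_sqrt_ge_zero zero_le_numeral
        add_nonneg_nonneg zero_le_divide_1_iff) simp
  also have "\<dots> \<le> ennreal (exp 1)"
  proof (rule ennreal_leI)
    have "sqrt 2 \<le> 2"
      by (rule real_le_lsqrt) auto
    also have "\<dots> \<le> exp 1"
      using exp_ge_add_one_self[of 1] by simp
    finally show "sqrt 2 \<le> exp 1" .
  qed
  finally show "(\<integral>\<^sup>+\<omega>. ennreal (exp ((cmod (\<Sum>k\<in>F. x k * complex_of_real (\<phi> k \<omega>)))\<^sup>2 / (sqrt 8 * b)\<^sup>2)) \<partial>coin_space)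
      \<le> ennreal (exp 1)" .
qed

end

section \<open>A confined random walk\<close>

text \<open>
  The indicator of the event \<open>\<bar>s\<bar> \<le> L\<close>, normalised in \<open>L\<^sub>2\<close>. If the event is a null set, division
  by 0 makes the gate 0, so that its second moment is at most 1 in every case.
\<close>

definition gate :: "real \<Rightarrow> ((nat \<Rightarrow> real) \<Rightarrow> real) \<Rightarrow> (nat \<Rightarrow> real) \<Rightarrow> real" where
  "gate L s \<omega> = (if \<bar>s \<omega>\<bar> \<le> L
     then 1 / sqrt (measure coin_space {\<omega>\<in>space coin_space. \<bar>s \<omega>\<bar> \<le> L}) else 0)"

lemma measurable_gate [measurable (raw)]:
  assumes [measurable]: "s \<in> borel_measurable coin_space"
  shows "gate L s \<in> borel_measurable coin_space"
proof -
  have "(\<lambda>\<omega>. if \<bar>s \<omega>\<bar> \<le> L then c else 0) \<in> borel_measurable coin_space" for c :: real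
    by measurable
  then show ?thesis
    unfolding gate_def[abs_def] .
qed

lemma determined_before_gate: "determined_before n s \<Longrightarrow> determined_before n (gate L s)"
  unfolding gate_def[abs_def] by (rule determined_before_comp)

lemma abs_gate_le: "\<bar>gate L s \<omega>\<bar> \<le> 1 / sqrt (measure coin_space {\<omega>\<in>space coin_space. \<bar>s \<omega>\<bar> \<le> L})"
  by (simp add: gate_def)

lemma integral_gate_squared:
  fixes L :: real
  assumes [measurable]: "s \<in> borel_measurable coin_space"
  defines "p \<equiv> measure coin_space {\<omega>\<in>space coin_space. \<bar>s \<omega>\<bar> \<le> L}"
  shows "(\<integral>\<omega>. (gate L s \<omega>)\<^sup>2 \<partial>coin_space) = (if p = 0 then 0 else 1)"
proof -
  have "(\<integral>\<omega>. (gate L s \<omega>)\<^sup>2 \<partial>coin_space)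
      = (\<integral>\<omega>. indicator {\<omega>\<in>space coin_space. \<bar>s \<omega>\<bar> \<le> L} \<omega> / p \<partial>coin_space)"
    by (intro Bochner_Integration.integral_cong refl)
       (auto simp: gate_def p_def power_divide indicator_def)
  also have "\<dots> = p / p"
    by (simp add: p_def)
  finally show ?thesis
    by simp
qed

text \<open>
  The walk makes its step number \<open>n + 1\<close> only from a position of modulus at most
  \<open>K * sqrt (n + 1)\<close>; otherwise it waits until this threshold has grown beyond its position.
\<close>

primrec walk :: "real \<Rightarrow> nat \<Rightarrow> (nat \<Rightarrow> real) \<Rightarrow> real" where
  "walk K 0 = (\<lambda>\<omega>. 0)"
| "walk K (Suc n) = (\<lambda>\<omega>. walk K n \<omega> + \<omega> (Suc n) * gate (K * sqrt (Suc n)) (walk K n) \<omega>)"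

lemma walk_measurable [measurable]: "walk K n \<in> borel_measurable coin_space"
  by (induction n) auto

lemma walk_determined: "determined_before (Suc n) (walk K n)"
proof (induction n)
  case 0
  show ?case
    by (simp add: determined_before_const)
next
  case (Suc n)
  then have "determined_before (Suc (Suc n)) (walk K n)"
    by (rule determined_before_mono) simp
  note 1 = this determined_before_gate[OF this] determined_before_sign[of "Suc n" "Suc (Suc n)"]
  show ?case
    unfolding walk.simps
    by (rule determined_before_comp2[OF 1(1) determined_before_comp2[OF 1(3) 1(2)]]) simp
qed

text \<open>
  A crude bound, sufficient for integrability. The bound of order \<open>sqrt n\<close> needs a lower bound for the
  probabilities in the gates, which in turn comes from the second moment of the walk.
\<close>

lemma walk_bounded: "\<exists>B. \<forall>\<omega>\<in>space coin_space. \<bar>walk K n \<omega>\<bar> \<le> B"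
proof (induction n)
  case (Suc n)
  then obtain B where B: "\<And>\<omega>. \<omega> \<in> space coin_space \<Longrightarrow> \<bar>walk K n \<omega>\<bar> \<le> B"
    by blast
  let ?L = "K * sqrt (Suc n)"
  have "\<bar>walk K (Suc n) \<omega>\<bar> \<le> B + 1 / sqrt (measure coin_space {\<omega>\<in>space coin_space. \<bar>walk K n \<omega>\<bar> \<le> ?L})"
    if "\<omega> \<in> space coin_space" for \<omega>
  proof -
    have "\<bar>walk K (Suc n) \<omega>\<bar> \<le> \<bar>walk K n \<omega>\<bar> + \<bar>\<omega> (Suc n) * gate ?L (walk K n) \<omega>\<bar>"
      unfolding walk.simps by (rule abs_triangle_ineq)
    also have "\<bar>\<omega> (Suc n) * gate ?L (walk K n) \<omega>\<bar> = \<bar>gate ?L (walk K n) \<omega>\<bar>"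
      using that by (simp add: abs_mult)
    finally show ?thesis
      using B[OF that] abs_gate_le[of ?L "walk K n" \<omega>] by linarith
  qed
  then show ?case
    by blast
qed auto

lemma integrable_walk_squared: "integrable coin_space (\<lambda>\<omega>. (walk K n \<omega>)\<^sup>2)"
proof -
  obtain B where B: "\<And>\<omega>. \<omega> \<in> space coin_space \<Longrightarrow> \<bar>walk K n \<omega>\<bar> \<le> B"
    using walk_bounded by blast
  show ?thesis
  proof (rule coin_space.integrable_const_bound[where B = "B\<^sup>2"])
    show "AE \<omega> in coin_space. norm ((walk K n \<omega>)\<^sup>2) \<le> B\<^sup>2"
      using B by (intro AE_I2) (force simp: abs_le_square_iff[symmetric])
  qed measurable
qed

text \<open>
  The increments are orthogonal to the past and have second moment at most 1, the latter without
  any knowledge of the probabilities by which the gates are normalised.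
\<close>

lemma second_moment_walk_le: "(\<integral>\<omega>. (walk K n \<omega>)\<^sup>2 \<partial>coin_space) \<le> real n"
proof (induction n)
  case 0
  show ?case
    by simp
next
  case (Suc n)
  let ?w = "walk K n" and ?g = "gate (K * sqrt (Suc n)) (walk K n)"
  let ?cross = "\<lambda>\<omega>. 2 * (?w \<omega> * (\<omega> (Suc n) * ?g \<omega>))"
  have square: "(walk K (Suc n) \<omega>)\<^sup>2 = (?w \<omega>)\<^sup>2 + (?g \<omega>)\<^sup>2 + ?cross \<omega>" if "\<omega> \<in> space coin_space" for \<omega>
    using that by (simp add: power2_sum power_mult_distrib)
  have int_gate: "integrable coin_space (\<lambda>\<omega>. (?g \<omega>)\<^sup>2)"
  proof (rule coin_space.integrable_const_bound)
    show "AE \<omega> in coin_space. norm ((?g \<omega>)\<^sup>2)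
        \<le> (1 / sqrt (measure coin_space {\<omega>\<in>space coin_space. \<bar>?w \<omega>\<bar> \<le> K * sqrt (Suc n)}))\<^sup>2"
      using power_mono[OF abs_gate_le abs_ge_zero, of _ _ _ 2] by (intro AE_I2) simp
  qed measurable
  have int_sum: "integrable coin_space (\<lambda>\<omega>. (?w \<omega>)\<^sup>2 + (?g \<omega>)\<^sup>2)"
    using integrable_walk_squared int_gate by (rule Bochner_Integration.integrable_add)
  have "integrable coin_space (\<lambda>\<omega>. (walk K (Suc n) \<omega>)\<^sup>2 - ((?w \<omega>)\<^sup>2 + (?g \<omega>)\<^sup>2))"
    using integrable_walk_squared int_sum by (rule Bochner_Integration.integrable_diff)
  \<comment> \<open>The mixed term is the difference of integrable functions: the square of the next position, minus the two other squares.\<close>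
  then have int_cross: "integrable coin_space ?cross"
    by (rule Bochner_Integration.integrable_cong[THEN iffD1, OF refl, rotated]) (use square in auto)
  have cross: "(\<integral>\<omega>. ?cross \<omega> \<partial>coin_space) = 0"
  proof (rule integral_eq_0_if_flip_odd[of _ "Suc n"])
    fix \<omega> assume \<omega>: "\<omega> \<in> space coin_space"
    have "?w (flip (Suc n) \<omega>) = ?w \<omega>" "?g (flip (Suc n) \<omega>) = ?g \<omega>"
      using \<omega> by (auto intro: determined_before_flip[OF walk_determined] determined_before_flip[OF determined_before_gate[OF walk_determined]])
    moreover have "flip (Suc n) \<omega> (Suc n) = - \<omega> (Suc n)"
      by (simp add: flip_def)
    ultimately show "?cross (flip (Suc n) \<omega>) = - ?cross \<omega>"
      by simp
  qed measurable
  have "(\<integral>\<omega>. (walk K (Suc n) \<omega>)\<^sup>2 \<partial>coin_space) = (\<integral>\<omega>. (?w \<omega>)\<^sup>2 + (?g \<omega>)\<^sup>2 + ?cross \<omega> \<partial>coin_space)"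
    using square by (rule Bochner_Integration.integral_cong[OF refl])
  also have "\<dots> = (\<integral>\<omega>. (?w \<omega>)\<^sup>2 \<partial>coin_space) + (\<integral>\<omega>. (?g \<omega>)\<^sup>2 \<partial>coin_space) + (\<integral>\<omega>. ?cross \<omega> \<partial>coin_space)"
    by (simp only: Bochner_Integration.integral_add[OF int_sum int_cross]
        Bochner_Integration.integral_add[OF integrable_walk_squared int_gate])
  also have "\<dots> \<le> real n + 1"
    using Suc.IH integral_gate_squared[of ?w "K * sqrt (Suc n)"] unfolding cross by simp
  finally show ?case
    by simp
qed

text \<open>
  Chebyshev's inequality: the threshold grows like the square root of the second moment, so the
  probability that the next step is suppressed is at most \<open>1 / K\<^sup>2\<close> at all times.
\<close>

lemma prob_walk_confined:
  assumes "K > 0"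
  shows "1 - 1 / K\<^sup>2 \<le> measure coin_space {\<omega>\<in>space coin_space. \<bar>walk K n \<omega>\<bar> \<le> K * sqrt (Suc n)}"
proof -
  let ?L = "K * sqrt (Suc n)"
  let ?E = "{\<omega>\<in>space coin_space. \<bar>walk K n \<omega>\<bar> \<le> ?L}"
  have L: "?L > 0"
    using assms by (intro mult_pos_pos) auto
  have "1 - measure coin_space ?E = measure coin_space (space coin_space - ?E)"
    by (rule coin_space.prob_compl[symmetric]) measurable
  also have "\<dots> \<le> measure coin_space {\<omega>\<in>space coin_space. \<bar>walk K n \<omega>\<bar> \<ge> ?L}"
    by (rule coin_space.finite_measure_mono) auto
  also have "\<dots> \<le> (\<integral>\<omega>. (walk K n \<omega>)\<^sup>2 \<partial>coin_space) / ?L\<^sup>2"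
    using L by (intro coin_space.second_moment_method integrable_walk_squared walk_measurable)
  also have "\<dots> \<le> real (Suc n) / ?L\<^sup>2"
    using second_moment_walk_le[of K n] by (intro divide_right_mono) auto
  also have "\<dots> = 1 / K\<^sup>2"
    by (simp add: power_mult_distrib)
  finally show ?thesis
    by simp
qed

theorem theorem1:
  fixes \<epsilon> :: real
  assumes "\<epsilon> > 0"
  shows "\<exists>\<delta> > 0. \<exists>(M :: (nat \<Rightarrow> real) measure) (\<phi> :: nat \<Rightarrow> (nat \<Rightarrow> real) \<Rightarrow> real).
    prob_space M \<and>
    orthonormal_system M \<phi> {1..} \<and>
    (\<forall>n\<ge>1. Linf_norm M (\<lambda>\<omega>. complex_of_real (\<phi> n \<omega>)) \<le> ereal (1 + \<epsilon>)) \<and>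
    martingale_difference M \<phi> \<and>
    subgaussian M (\<lambda>n \<omega>. complex_of_real (\<phi> n \<omega>)) {1..} \<and>
    (\<forall>F (x :: nat \<Rightarrow> real). finite F \<and> F \<subseteq> {1..} \<longrightarrow>
       (\<integral>\<^sup>+\<omega>. ennreal (exp (\<Sum>k\<in>F. x k * \<phi> k \<omega>)) \<partial>M)
         \<le> ennreal (exp ((1 + \<epsilon>)\<^sup>2 * (\<Sum>k\<in>F. (x k)\<^sup>2) / 2))) \<and>
    \<not> sidon M (\<lambda>n \<omega>. complex_of_real (\<phi> n \<omega>)) {1..} \<and>
    (\<exists>C :: nat \<Rightarrow> real. \<forall>n\<ge>1.
       is_smallest {c. sidon_bound M (\<lambda>k \<omega>. complex_of_real (\<phi> k \<omega>)) {1..n} c} (C n) \<and>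
       C n \<ge> \<delta> * sqrt (real n))"
proof -
  define b where "b = 1 + \<epsilon>"
  have b: "b > 1"
    using assms by (simp add: b_def)
  then have b2: "b\<^sup>2 > 1"
    by (simp add: one_less_power)
  \<comment> \<open>Chosen so that the gates are open with probability at least \<open>1 / b\<^sup>2\<close>, which keeps their height at most \<open>b\<close>.\<close>
  define K where "K = b / sqrt (b\<^sup>2 - 1)"
  have K: "K > 0" "1 - 1 / K\<^sup>2 = 1 / b\<^sup>2"
    using b b2 by (simp_all add: K_def power_divide diff_divide_distrib)
  \<comment> \<open>The system is indexed from 1; the gate with index 0 is constantly 1.\<close>
  define h where "h n = gate (K * sqrt n) (walk K (n - 1))" for n
  have confined: "1 / b\<^sup>2 \<le> measure coin_space {\<omega>\<in>space coin_space. \<bar>walk K (n - 1) \<omega>\<bar> \<le> K * sqrt n}" for n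
  proof (cases n)
    case 0
    then show ?thesis
      using b2 by (simp add: coin_space.prob_space divide_le_eq)
  next
    case (Suc m)
    then show ?thesis
      using prob_walk_confined[OF K(1), of m] K(2) by simp
  qed
  have h_le: "\<bar>h n \<omega>\<bar> \<le> b" for n \<omega>
  proof -
    have sqrt_ge: "1 / b \<le> sqrt (measure coin_space {\<omega>\<in>space coin_space. \<bar>walk K (n - 1) \<omega>\<bar> \<le> K * sqrt n})"
      using confined[of n] by (intro real_le_rsqrt) (simp add: power_divide)
    have "0 < 1 / b"
      using b by simp
    with sqrt_ge have "1 / sqrt (measure coin_space {\<omega>\<in>space coin_space. \<bar>walk K (n - 1) \<omega>\<bar> \<le> K * sqrt n}) \<le> 1 / (1 / b)"
      by (intro divide_left_mono mult_pos_pos) (linarith | simp)+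
    then show ?thesis
      using abs_gate_le[of "K * sqrt n" "walk K (n - 1)" \<omega>] by (simp add: h_def)
  qed
  interpret gated_signs h b
  proof
    show "determined_before n (h n)" for n
      unfolding h_def using walk_determined[of "n - 1" K]
      by (intro determined_before_gate) (cases n; simp add: determined_before_const)
  qed (use h_le in \<open>auto simp: h_def\<close>)
  have orth: "orthonormal_system coin_space \<phi> I" for I
  proof (rule orthonormal)
    fix n
    have "measure coin_space {\<omega>\<in>space coin_space. \<bar>walk K (n - 1) \<omega>\<bar> \<le> K * sqrt n} > 0"
      using confined[of n] b2 by (smt (verit) divide_pos_pos)
    then show "(\<integral>\<omega>. (h n \<omega>)\<^sup>2 \<partial>coin_space) = 1"
      by (simp add: h_def integral_gate_squared)
  qed
  have walk_Suc: "walk K (Suc n) \<omega> = walk K n \<omega> + \<phi> (Suc n) \<omega>" for n \<omega>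
    unfolding \<phi>_def h_def by simp
  have walk_eq: "(\<Sum>k\<in>{1..n}. \<phi> k \<omega>) = walk K n \<omega>" for n \<omega>
    by (induction n) (simp_all add: walk_Suc del: walk.simps(2))
  \<comment> \<open>A step starts below the threshold and has length at most \<open>b\<close>; a waiting walk keeps its bound.\<close>
  have walk_le: "\<bar>walk K n \<omega>\<bar> \<le> K * sqrt n + b" if \<omega>: "\<omega> \<in> space coin_space" for n \<omega>
  proof (induction n)
    case 0
    show ?case
      using b by simp
  next
    case (Suc n)
    show ?case
    proof (cases "\<bar>walk K n \<omega>\<bar> \<le> K * sqrt (Suc n)")
      case True
      then show ?thesis
        using walk_Suc[of n \<omega>] phi_bounded[OF \<omega>, of "Suc n"] by linarith
    next
      case False
      then have "walk K (Suc n) \<omega> = walk K n \<omega>"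
        by (simp add: gate_def)
      moreover have "K * sqrt n \<le> K * sqrt (Suc n)"
        using K(1) by simp
      ultimately show ?thesis
        using Suc.IH by linarith
    qed
  qed
  define \<delta> where "\<delta> = 1 / (K + b)"
  have \<delta>: "\<delta> > 0"
    using K(1) b by (simp add: \<delta>_def)
  let ?\<phi> = "\<lambda>k \<omega>. complex_of_real (\<phi> k \<omega>)"
  have lower: "\<delta> * sqrt n \<le> c" if n: "n \<ge> 1" and c: "sidon_bound coin_space ?\<phi> {1..n} c" for n c
  proof -
    have "real (card {1..n}) \<le> c * ((K + b) * sqrt n)"
    proof (rule sidon_bound_card_le[OF prob_space_coin_space _ c])
      fix \<omega> assume "\<omega> \<in> space coin_space"
      then have "\<bar>\<Sum>k\<in>{1..n}. \<phi> k \<omega>\<bar> \<le> K * sqrt n + b"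
        unfolding walk_eq by (rule walk_le)
      also have "\<dots> \<le> (K + b) * sqrt n"
        using b n by (simp add: distrib_right)
      finally show "cmod (\<Sum>k\<in>{1..n}. ?\<phi> k \<omega>) \<le> (K + b) * sqrt n"
        by (simp flip: of_real_sum)
    qed (use n in auto)
    then have "sqrt n * sqrt n \<le> (c * (K + b)) * sqrt n"
      by (simp add: mult.assoc)
    then have "sqrt n \<le> c * (K + b)"
      by (rule mult_right_le_imp_le) (use n in simp)
    then show ?thesis
      using K(1) b by (simp add: \<delta>_def divide_le_eq)
  qed
  have not_sidon: "\<not> sidon coin_space ?\<phi> {1..}"
  proof
    assume "sidon coin_space ?\<phi> {1..}"
    then obtain C where C: "\<And>F. finite F \<Longrightarrow> F \<subseteq> {1..} \<Longrightarrow> sidon_bound coin_space ?\<phi> F C"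
      unfolding sidon_def by blast
    obtain n :: nat where n: "real n > (C / \<delta>)\<^sup>2"
      using reals_Archimedean2 by blast
    then have "real n > 0"
      by (rule le_less_trans[OF zero_le_power2])
    then have "n \<ge> 1"
      by simp
    then have "\<delta> * sqrt n \<le> C"
      by (intro lower C) auto
    then have "sqrt n \<le> C / \<delta>"
      using \<delta> by (simp add: le_divide_eq mult.commute)
    then have "(sqrt n)\<^sup>2 \<le> (C / \<delta>)\<^sup>2"
      by (rule power_mono) simp
    with n show False
      by simp
  qed
  have "\<exists>c. is_smallest {c. sidon_bound coin_space ?\<phi> {1..n} c} c" if "n \<ge> 1" for n
    using that phi_bounded by (intro ex_smallest_sidon_bound[OF prob_space_coin_space _ _ orth]) auto
  then obtain C where C: "\<And>n. n \<ge> 1 \<Longrightarrow> is_smallest {c. sidon_bound coin_space ?\<phi> {1..n} c} (C n)"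
    by metis
  have C_ge: "\<delta> * sqrt n \<le> C n" if "n \<ge> 1" for n
    using lower[OF that] C[OF that] by (auto simp: is_smallest_def)
  have Linf: "Linf_norm coin_space (?\<phi> n) \<le> ereal (1 + \<epsilon>)" for n
    unfolding Linf_norm_def using phi_bounded[of _ n] by (intro esssup_I AE_I2) (auto simp: b_def)
  have "b > 0"
    using b by simp
  show ?thesis
    using \<delta> prob_space_coin_space orth Linf martingale_difference subgaussian[OF \<open>b > 0\<close>] exp_moment
      not_sidon C C_ge unfolding b_def
    by (intro exI[of _ \<delta>] exI[of _ coin_space] exI[of _ \<phi>] conjI exI[of _ C] allI impI) blast+
qed

end
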